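(* Let $\mathbf{s}_1,\dots,\mathbf{s}_M\in\mathbb{R}^n$ ($M\ge 2$, $n\ge1$) be any constellation of distinct points with any bit mapping (this includes coding under maximum likelihood decoding). Then the bit error rate $\mathrm{BER}$ of the maximum likelihood detector in the AWGN channel is a convex function of the SNR $\gamma=1/\sigma_0^2$ in the high SNR/small noise regime $$d_{\min}^2\ge (n+\sqrt{2n})\,\sigma_0^2,$$ i.e. on $\{\gamma:\gamma\ge (n+\sqrt{2n})/d_{\min}^2\}$, where $d_{\min}$ is the minimum distance from a constellation point to the boundary of its decision region, minimized over the constellation.
   Context: Channel: $\mathbf{r}=\mathbf{s}+\boldsymbol{\xi}$, where $\mathbf{s}\in\{\mathbf{s}_1,\dots,\mathbf{s}_M\}\subset\mathbb{R}^n$ is the transmitted point and $\boldsymbol{\xi}\sim\mathcal{N}(\mathbf{0},\sigma_0^2\mathbf{I})$ has density $p_\xi(\mathbf{x})=(2\pi\sigma_0^2)^{-n/2}e^{-|\mathbf{x}|^2/(2\sigma_0^2)}$, with $|\cdot|$ the Euclidean norm. The constellation is normalized by $\frac1M\sum_{k=1}^M|\mathbf{s}_k|^2=1$ and the SNR is $\gamma=1/\sigma_0^2$; the constellation, bit mapping and prior probabilities $\Pr\{\mathbf{s}=\mathbf{s}_i\}$ are fixed while $\gamma$ varies. (Codewords of a code under maximum likelihood decoding are regarded as points of a constellation.) The maximum likelihood (minimum distance) detector outputs $\hat{\mathbf{s}}=\arg\min_{\mathbf{s}_k}|\mathbf{r}-\mathbf{s}_k|$. The decision region of $\mathbf{s}_k$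 is its closed Voronoi cell $V_k=\{\mathbf{r}\in\mathbb{R}^n: |\mathbf{r}-\mathbf{s}_k|\le|\mathbf{r}-\mathbf{s}_l|\ \forall l\}$. The pairwise error probability is $\Pr\{\mathbf{s}_i\to\mathbf{s}_j\}=\Pr[\hat{\mathbf{s}}=\mathbf{s}_j\mid\mathbf{s}=\mathbf{s}_i]=\int_{V_j-\mathbf{s}_i}p_\xi(\mathbf{x})\,d\mathbf{x}$ for $i\neq j$. A bit mapping assigns to each $\mathbf{s}_k$ a binary sequence (all of a common length); $h_{ij}$ is the Hamming distance between the sequences representing $\mathbf{s}_i$ and $\mathbf{s}_j$. The bit error rate is $$\mathrm{BER}=\sum_{i=1}^M\sum_{j\ne i}\frac{h_{ij}}{\log_2 M}\Pr\{\mathbf{s}=\mathbf{s}_i\}\Pr\{\mathbf{s}_i\to\mathbf{s}_j\}.$$ Notation: $d_{\min,i}=\min_{k\ne i}\frac12|\mathbf{s}_k-\mathbf{s}_i|$ is the minimum distance from $\mathbf{s}_i$ to the boundary of $V_i$, and $d_{\min}=\min_i d_{\min,i}$. *)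

theory Defs
  imports "HOL-Analysis.Analysis"
begin

text \<open>
  A constellation of \<open>M\<close> points is a function \<open>s\<close> on \<open>nat\<close>, of which only the values on \<open>{1..M}\<close>
  matter. Throughout, \<open>sd\<close> is the standard deviation of the noise in each coordinate.
\<close>

definition noise_density :: "real \<Rightarrow> real ^ 'n \<Rightarrow> real" where
  "noise_density sd x =
     (2 * pi * sd\<^sup>2) powr (- real CARD('n) / 2) * exp (- (norm x)\<^sup>2 / (2 * sd\<^sup>2))"

definition decision_region :: "nat \<Rightarrow> (nat \<Rightarrow> real ^ 'n) \<Rightarrow> nat \<Rightarrow> (real ^ 'n) set" where
  "decision_region M s k = {r. \<forall>l\<in>{1..M}. norm (r - s k) \<le> norm (r - s l)}"

text \<open>
  The decision regions overlap only on null sets (for distinct points), so that the rule for breaking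
  ties does not matter. The region is translated to be centred at the transmitted point \<open>s i\<close>.
\<close>

definition pairwise_error_prob :: "nat \<Rightarrow> (nat \<Rightarrow> real ^ 'n) \<Rightarrow> real \<Rightarrow> nat \<Rightarrow> nat \<Rightarrow> real" where
  "pairwise_error_prob M s sd i j =
     (LINT x : (\<lambda>r. r - s i) ` decision_region M s j | lborel. noise_density sd x)"

text \<open>Only used for sequences of the same length.\<close>

definition hamming_dist :: "bool list \<Rightarrow> bool list \<Rightarrow> nat" where
  "hamming_dist u v = card {l. l < length u \<and> u ! l \<noteq> v ! l}"

definition bit_error_rate ::
  "nat \<Rightarrow> (nat \<Rightarrow> real ^ 'n) \<Rightarrow> (nat \<Rightarrow> bool list) \<Rightarrow> (nat \<Rightarrow> real) \<Rightarrow> real \<Rightarrow> real" where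
  "bit_error_rate M s bits prior sd =
     (\<Sum>i\<in>{1..M}. \<Sum>j\<in>{1..M} - {i}.
        real (hamming_dist (bits i) (bits j)) / log 2 (real M)
          * prior i * pairwise_error_prob M s sd i j)"

definition min_dist_at :: "nat \<Rightarrow> (nat \<Rightarrow> real ^ 'n) \<Rightarrow> nat \<Rightarrow> real" where
  "min_dist_at M s i = Min ((\<lambda>k. 1 / 2 * norm (s k - s i)) ` ({1..M} - {i}))"

definition min_dist :: "nat \<Rightarrow> (nat \<Rightarrow> real ^ 'n) \<Rightarrow> real" where
  "min_dist M s = Min (min_dist_at M s ` {1..M})"

text \<open>
  The BER as a function of the SNR \<open>gamma = 1 / sd\<^sup>2\<close>: for \<open>gamma > 0\<close>, the noise level with this
  SNR is \<open>sd = 1 / sqrt gamma\<close>.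
\<close>

definition ber_of_snr ::
  "nat \<Rightarrow> (nat \<Rightarrow> real ^ 'n) \<Rightarrow> (nat \<Rightarrow> bool list) \<Rightarrow> (nat \<Rightarrow> real) \<Rightarrow> real \<Rightarrow> real" where
  "ber_of_snr M s bits prior gamma = bit_error_rate M s bits prior (1 / sqrt gamma)"

end

theory Submission
  imports Defs "HOL-Probability.Distributions"
begin

text \<open>
  As a function of the SNR \<open>\<gamma>\<close>, the noise density at \<open>x\<close> is a constant times
  \<open>\<gamma> powr (n/2) * exp (- \<gamma> * |x|\<^sup>2 / 2)\<close>, whose second derivative has the sign of
  \<open>(\<gamma> * |x|\<^sup>2 - n)\<^sup>2 - 2 * n\<close>. A decision error forces \<open>|x| \<ge> min_dist M s\<close>, so in the given regime the density
  is convex in \<open>\<gamma>\<close> at every point of the domain of integration, and convexity passes to the integral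
  without differentiating under it.
\<close>

text \<open>Needed because the closed form in \<open>noise_density_snr\<close> is available only for
  positive SNR, so the two functions agree on \<open>A\<close> but perhaps not everywhere.\<close>

lemma convex_on_eq:
  assumes f: "convex_on A f" and eq: "\<And>x. x \<in> A \<Longrightarrow> g x = f x"
  shows "convex_on A g"
  using f unfolding convex_on_def by (auto simp: eq convexD)

lemma convex_on_sum_fun:
  assumes "convex A" "\<And>i. i \<in> I \<Longrightarrow> convex_on A (f i)"
  shows "convex_on A (\<lambda>x. \<Sum>i\<in>I. f i x)"
  using assms(2)
  by (induction I rule: infinite_finite_induct) (use assms(1) in \<open>auto intro: convex_on_add simp: convex_on_const\<close>)

text \<open>Integrate the pointwise convexity inequality, using monotonicity and linearity of the
  integral. Integrability at every parameter in \<open>C\<close> excludes the default value 0 of a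
  divergent integral.\<close>

lemma convex_on_set_integral:
  fixes f :: "'a::real_vector \<Rightarrow> 'b \<Rightarrow> real"
  assumes "convex C"
    and integrable: "\<And>c. c \<in> C \<Longrightarrow> set_integrable M A (f c)"
    and convex: "\<And>x. x \<in> A \<Longrightarrow> convex_on C (\<lambda>c. f c x)"
  shows "convex_on C (\<lambda>c. LINT x:A|M. f c x)"
proof (rule convex_onI)
  fix t :: real and a b
  assume t: "t > 0" "t < 1" and ab: "a \<in> C" "b \<in> C"
  have mem: "(1 - t) *\<^sub>R a + t *\<^sub>R b \<in> C"
    using \<open>convex C\<close> ab t by (simp add: convex_def)
  have int: "set_integrable M A (\<lambda>x. (1 - t) * f a x)" "set_integrable M A (\<lambda>x. t * f b x)"
    using integrable ab by auto
  have "(LINT x:A|M. f ((1 - t) *\<^sub>R a + t *\<^sub>R b) x) \<le> (LINT x:A|M. (1 - t) * f a x + t * f b x)"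
  proof (rule set_integral_mono)
    show "f ((1 - t) *\<^sub>R a + t *\<^sub>R b) x \<le> (1 - t) * f a x + t * f b x" if "x \<in> A" for x
      using convex[OF that] t ab by (simp add: convex_on_def)
  qed (use integrable mem int in \<open>auto intro: set_integral_add\<close>)
  also have "\<dots> = (1 - t) * (LINT x:A|M. f a x) + t * (LINT x:A|M. f b x)"
    using int by simp
  finally show "(LINT x:A|M. f ((1 - t) *\<^sub>R a + t *\<^sub>R b) x)
    \<le> (1 - t) * (LINT x:A|M. f a x) + t * (LINT x:A|M. f b x)" .
qed fact

text \<open>The sign of the second derivative is that of \<open>(a * x - m)\<^sup>2 - m\<close>,
  which is nonnegative once \<open>a * x\<close> reaches \<open>m + sqrt m\<close>. The hypothesis
  says this at the left endpoint \<open>c\<close>.\<close>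

lemma convex_on_powr_exp:
  fixes a c m :: real
  assumes "c > 0" "m \<ge> 0" "a * c \<ge> m + sqrt m"
  shows "convex_on {c..} (\<lambda>x. x powr m * exp (- (a * x)))"
proof (rule f''_ge0_imp_convex)
  show "convex {c..}" by simp
  fix x assume "x \<in> {c..}"
  then have x: "x > 0" "x \<ge> c" using \<open>c > 0\<close> by auto
  \<comment> \<open>All powers are reduced to \<open>x powr (m - 2)\<close>, the common factor of
    the second derivative.\<close>
  have x1: "x powr (m - 1) = x * x powr (m - 2)" and x2: "x powr m = x\<^sup>2 * x powr (m - 2)"
    using x by (simp_all add: powr_diff power2_eq_square)
  show "((\<lambda>x. x powr m * exp (- (a * x))) has_real_derivative
      (m * x powr (m - 1) - a * x powr m) * exp (- (a * x))) (at x)"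
    using x by (auto intro!: derivative_eq_intros simp: algebra_simps)
  show "((\<lambda>x. (m * x powr (m - 1) - a * x powr m) * exp (- (a * x))) has_real_derivative
      x powr (m - 2) * exp (- (a * x)) * ((a * x - m)\<^sup>2 - m)) (at x)"
    using x by (auto intro!: derivative_eq_intros
        simp: x1 x2 diff_diff_eq power2_eq_square algebra_simps)
  \<comment> \<open>A negative \<open>a\<close> would make \<open>a * c\<close> negative, below
    \<open>m + sqrt m\<close>. With \<open>a\<close> nonnegative, the bound at \<open>c\<close>
    carries over to all larger \<open>x\<close>.\<close>
  have "0 \<le> a"
    using assms by (smt (verit) mult_neg_pos real_sqrt_ge_zero)
  then have "sqrt m \<le> a * x - m"
    using assms(3) x mult_left_mono[of c x a] by linarith
  then have "m \<le> (a * x - m)\<^sup>2"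
    using \<open>m \<ge> 0\<close> by (metis power_mono real_sqrt_ge_zero real_sqrt_pow2)
  then show "0 \<le> x powr (m - 2) * exp (- (a * x)) * ((a * x - m)\<^sup>2 - m)"
    by simp
qed

text \<open>Isolates the dependence on the SNR in the shape of \<open>convex_on_powr_exp\<close>,
  with \<open>m\<close> being half the dimension and \<open>a\<close> being
  \<open>(norm x)\<^sup>2 / 2\<close>.\<close>

lemma noise_density_snr:
  fixes x :: "real ^ 'n"
  assumes "g > 0"
  shows "noise_density (1 / sqrt g) x = (2 * pi) powr (- real CARD('n) / 2)
    * (g powr (real CARD('n) / 2) * exp (- ((norm x)\<^sup>2 / 2 * g)))"
  using assms by (simp add: noise_density_def power_divide powr_divide powr_minus_divide mult.commute)

lemma noise_density_eq_prod:
  fixes x :: "real ^ 'n"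
  assumes "sd > 0"
  shows "noise_density sd x = (\<Prod>b\<in>Basis. normal_density 0 sd (x \<bullet> b))"
proof -
  have "(2 * pi * sd\<^sup>2) powr (- real CARD('n) / 2) = ((2 * pi * sd\<^sup>2) powr (- 1 / 2)) powr real CARD('n)"
    by (simp add: powr_powr)
  also have "\<dots> = (1 / sqrt (2 * pi * sd\<^sup>2)) ^ CARD('n)"
    using assms by (simp add: powr_realpow powr_minus_divide powr_half_sqrt)
  finally have "(2 * pi * sd\<^sup>2) powr (- real CARD('n) / 2) = (1 / sqrt (2 * pi * sd\<^sup>2)) ^ CARD('n)" .
  moreover have "- (norm x)\<^sup>2 / (2 * sd\<^sup>2) = (\<Sum>b\<in>Basis. - (x \<bullet> b)\<^sup>2 / (2 * sd\<^sup>2))"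
    by (simp add: power2_norm_eq_inner euclidean_inner[of x x] sum_divide_distrib sum_negf
        flip: power2_eq_square)
  ultimately show ?thesis
    by (simp add: noise_density_def normal_density_def prod.distrib exp_sum prod_dividef power_one_over)
qed

text \<open>By the product form, the integral splits over the coordinates into one-dimensional
  normal integrals, each equal to 1.\<close>

lemma integrable_noise_density:
  assumes "sd > 0"
  shows "integrable lborel (noise_density sd :: real ^ 'n \<Rightarrow> real)"
proof (rule integrableI_nonneg)
  show "(noise_density sd :: real ^ 'n \<Rightarrow> real) \<in> borel_measurable lborel"
    unfolding noise_density_def[abs_def] by measurable
  show "AE x :: real ^ 'n in lborel. 0 \<le> noise_density sd x"
    by (simp add: noise_density_def)
  have "(\<integral>\<^sup>+ x. ennreal (noise_density sd x) \<partial>(lborel :: (real ^ 'n) measure))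
      = (\<integral>\<^sup>+ x. (\<Prod>b\<in>Basis. ennreal (normal_density 0 sd (x \<bullet> b))) \<partial>(lborel :: (real ^ 'n) measure))"
    by (simp add: noise_density_eq_prod[OF assms] prod_ennreal)
  also have "\<dots> = (\<Prod>b\<in>(Basis :: (real ^ 'n) set). \<integral>\<^sup>+ y. ennreal (normal_density 0 sd y) \<partial>lborel)"
    by (rule nn_integral_lborel_prod) auto
  also have "\<dots> = 1"
    using assms by (simp add: nn_integral_eq_integral)
  finally show "(\<integral>\<^sup>+ x. ennreal (noise_density sd x) \<partial>(lborel :: (real ^ 'n) measure)) < \<infinity>"
    by simp
qed

lemma closed_decision_region: "closed (decision_region M s k)"
proof -
  have "decision_region M s k = (\<Inter>l\<in>{1..M}. {r. norm (r - s k) \<le> norm (r - s l)})"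
    by (auto simp: decision_region_def)
  then show ?thesis
    by (auto intro!: closed_INT closed_Collect_le continuous_intros)
qed

lemma min_dist_at_le:
  assumes "k \<in> {1..M}" "k \<noteq> i"
  shows "min_dist_at M s i \<le> norm (s k - s i) / 2"
  unfolding min_dist_at_def using assms by (intro Min_le) auto

lemma min_dist_le:
  assumes "i \<in> {1..M}"
  shows "min_dist M s \<le> min_dist_at M s i"
  unfolding min_dist_def using assms by (intro Min_le) auto

lemma min_dist_pos:
  assumes "M \<ge> 2" "inj_on s {1..M}"
  shows "min_dist M s > 0"
proof -
  have "min_dist_at M s i > 0" if "i \<in> {1..M}" for i
  proof -
    \<comment> \<open>\<open>Min\<close> is meaningful only on a nonempty set; a second index exists
      since \<open>M\<close> is at least 2.\<close>
    have "{1..M} - {i} \<noteq> {}"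
    proof -
      have "(if i = 1 then 2 else 1) \<in> {1..M} - {i}" using assms(1) by auto
      then show ?thesis by blast
    qed
    then show ?thesis
      unfolding min_dist_at_def using assms(2) that
      by (subst Min_gr_iff) (auto simp: inj_on_eq_iff)
  qed
  then show ?thesis
    unfolding min_dist_def using assms(1) by (subst Min_gr_iff) auto
qed

text \<open>The received point \<open>x + s i\<close> is at least as close to \<open>s j\<close> as
  to \<open>s i\<close>, so the triangle inequality through it bounds
  \<open>norm (s j - s i)\<close> by \<open>2 * norm x\<close>.\<close>

lemma min_dist_le_norm_noise:
  assumes "i \<in> {1..M}" "j \<in> {1..M}" "j \<noteq> i" "x \<in> (\<lambda>r. r - s i) ` decision_region M s j"
  shows "min_dist M s \<le> norm x"
proof -
  have "norm (x + s i - s j) \<le> norm x"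
    using assms(1,4) by (auto simp: decision_region_def)
  then have "norm (s j - s i) \<le> 2 * norm x"
    using norm_triangle_ineq4[of x "x + s i - s j"] by simp
  then show ?thesis
    using min_dist_le[OF assms(1), of s] min_dist_at_le[OF assms(2,3), of s] by linarith
qed

lemma convex_on_pairwise_error_prob:
  fixes s :: "nat \<Rightarrow> real ^ 'n"
  assumes "i \<in> {1..M}" "j \<in> {1..M}" "j \<noteq> i" and d: "min_dist M s > 0"
  shows "convex_on {(real CARD('n) + sqrt (2 * real CARD('n))) / (min_dist M s)\<^sup>2..}
    (\<lambda>g. pairwise_error_prob M s (1 / sqrt g) i j)"
    (is "convex_on {?c..} _")
  unfolding pairwise_error_prob_def
proof (rule convex_on_set_integral)
  \<comment> \<open>Keeps the SNR away from 0, so that \<open>1 / sqrt g\<close> is a genuine noise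
    level.\<close>
  have c: "?c > 0"
    using d by (simp add: add_pos_nonneg)
  show "convex {?c..}" by simp
  show "set_integrable lborel ((\<lambda>r. r - s i) ` decision_region M s j) (noise_density (1 / sqrt g))"
    if "g \<in> {?c..}" for g
  proof (rule set_integrable_subset)
    have "g > 0" using c that by auto
    then show "set_integrable lborel UNIV (noise_density (1 / sqrt g) :: real ^ 'n \<Rightarrow> real)"
      by (simp add: set_integrable_def integrable_noise_density)
    show "(\<lambda>r. r - s i) ` decision_region M s j \<in> sets lborel"
      by (simp add: borel_closed closed_translation_subtract closed_decision_region)
  qed simp
  show "convex_on {?c..} (\<lambda>g. noise_density (1 / sqrt g) x)"
    if "x \<in> (\<lambda>r. r - s i) ` decision_region M s j" for x
  proof -
    have "(min_dist M s)\<^sup>2 \<le> (norm x)\<^sup>2"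
      using min_dist_le_norm_noise[OF assms(1-3) that] d by (simp add: power_mono)
    then have "(min_dist M s)\<^sup>2 * ?c \<le> (norm x)\<^sup>2 * ?c"
      using c by (intro mult_right_mono) auto
    then have "real CARD('n) + sqrt (2 * real CARD('n)) \<le> (norm x)\<^sup>2 * ?c"
      using d by simp
    \<comment> \<open>Halving the preceding bound then gives exactly the threshold
      \<open>m + sqrt m\<close> for \<open>m\<close> equal to half the dimension.\<close>
    moreover have "sqrt (real CARD('n) / 2) = sqrt (2 * real CARD('n)) / 2"
      by (simp add: real_sqrt_divide real_sqrt_mult field_simps)
    ultimately have "convex_on {?c..}
        (\<lambda>g. g powr (real CARD('n) / 2) * exp (- ((norm x)\<^sup>2 / 2 * g)))"
      using c by (intro convex_on_powr_exp) auto
    then have "convex_on {?c..} (\<lambda>g. (2 * pi) powr (- real CARD('n) / 2) *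
        (g powr (real CARD('n) / 2) * exp (- ((norm x)\<^sup>2 / 2 * g))))"
      by (intro convex_on_cmul) auto
    moreover have "noise_density (1 / sqrt g) x = (2 * pi) powr (- real CARD('n) / 2) *
        (g powr (real CARD('n) / 2) * exp (- ((norm x)\<^sup>2 / 2 * g)))" if "g \<in> {?c..}" for g
      using that c by (intro noise_density_snr) (meson atLeast_iff less_le_trans)
    ultimately show ?thesis
      by (rule convex_on_eq)
  qed
qed

theorem theorem4:
  fixes s :: "nat \<Rightarrow> real ^ 'n"
    and M L :: nat
    and bits :: "nat \<Rightarrow> bool list"
    and prior :: "nat \<Rightarrow> real"
  assumes "M \<ge> 2"
    and "inj_on s {1..M}"
    and "1 / real M * (\<Sum>k\<in>{1..M}. (norm (s k))\<^sup>2) = 1"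
    and "\<forall>k\<in>{1..M}. length (bits k) = L"
    and "\<forall>i\<in>{1..M}. prior i \<ge> 0"
    and "(\<Sum>i\<in>{1..M}. prior i) = 1"
  shows "convex_on {gamma. gamma \<ge> (real CARD('n) + sqrt (2 * real CARD('n))) / (min_dist M s)\<^sup>2}
           (ber_of_snr M s bits prior)"
proof -
  have "convex_on {(real CARD('n) + sqrt (2 * real CARD('n))) / (min_dist M s)\<^sup>2..}
      (ber_of_snr M s bits prior)"
    \<comment> \<open>The BER is a combination of pairwise error probabilities whose weights are
      nonnegative: \<open>prior\<close> is, and \<open>log 2 (real M)\<close> is positive for
      \<open>M\<close> at least 2.\<close>
    unfolding ber_of_snr_def[abs_def] bit_error_rate_def
    using assms(1,5) min_dist_pos[OF assms(1,2)]
    by (intro convex_on_sum_fun convex_on_cmul convex_on_pairwise_error_prob) auto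
  then show ?thesis
    by (simp add: atLeast_def)
qed

end
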